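(* Let $p$ be a prime and let $R$ be a non-commutative ring whose order is a power of $p$. Then $|\operatorname{Cent}(R)| \geq p + 2$, and equality holds if and only if the additive quotient group $R/Z(R)$ is isomorphic, as a group, to $\mathbb{Z}_p \times \mathbb{Z}_p$.
   Context: Rings are associative and not assumed to have a unity. For $r \in R$, the centralizer of $r$ is the subring $C(r) = \{s \in R : rs = sr\}$, and $\operatorname{Cent}(R) = \{C(r) : r \in R\}$ is the set of all distinct centralizers. $Z(R) = \{s \in R : rs = sr \text{ for all } r \in R\}$ is the center. $R/Z(R)$ denotes the quotient of additive groups, and $\cong$ is isomorphism of additive groups. *)

theory Defs
  imports "HOL-Computational_Algebra.Primes" "HOL-Algebra.Elementary_Groups" "HOL-Algebra.AbelCoset"
begin

text \<open>
  The locale \<^locale>\<open>ring\<close> requires a unity, so rings that need not have one get a locale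
  of their own, over the same records. The field \<^const>\<open>one\<close> of the record is left
  unconstrained: it need not even lie in the carrier.
\<close>

locale nonunital_ring = abelian_group R for R (structure) +
  assumes m_closed: "\<lbrakk>x \<in> carrier R; y \<in> carrier R\<rbrakk> \<Longrightarrow> x \<otimes> y \<in> carrier R"
    and m_assoc: "\<lbrakk>x \<in> carrier R; y \<in> carrier R; z \<in> carrier R\<rbrakk>
      \<Longrightarrow> (x \<otimes> y) \<otimes> z = x \<otimes> (y \<otimes> z)"
    and l_distr: "\<lbrakk>x \<in> carrier R; y \<in> carrier R; z \<in> carrier R\<rbrakk>
      \<Longrightarrow> (x \<oplus> y) \<otimes> z = x \<otimes> z \<oplus> y \<otimes> z"
    and r_distr: "\<lbrakk>x \<in> carrier R; y \<in> carrier R; z \<in> carrier R\<rbrakk>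
      \<Longrightarrow> z \<otimes> (x \<oplus> y) = z \<otimes> x \<oplus> z \<otimes> y"

lemma (in ring) nonunital_ring: "nonunital_ring R"
  by unfold_locales (auto simp: m_assoc l_distr r_distr)

definition ring_centralizer :: "('a, 'm) ring_scheme \<Rightarrow> 'a \<Rightarrow> 'a set"
  where "ring_centralizer R r = {s \<in> carrier R. r \<otimes>\<^bsub>R\<^esub> s = s \<otimes>\<^bsub>R\<^esub> r}"

definition ring_Cent :: "('a, 'm) ring_scheme \<Rightarrow> 'a set set"
  where "ring_Cent R = {ring_centralizer R r |r. r \<in> carrier R}"

definition ring_center :: "('a, 'm) ring_scheme \<Rightarrow> 'a set"
  where "ring_center R = {s \<in> carrier R. \<forall>r \<in> carrier R. r \<otimes>\<^bsub>R\<^esub> s = s \<otimes>\<^bsub>R\<^esub> r}"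

text \<open>
  The quotient by the center is formed below with \<^const>\<open>A_FactGroup\<close>, for which the center
  has to be a subgroup of the additive group.
\<close>

lemma (in nonunital_ring) additive_subgroup_ring_center:
  "additive_subgroup (ring_center R) R"
proof -
  have z: "\<zero> \<otimes> r = \<zero>" "r \<otimes> \<zero> = \<zero>" if r: "r \<in> carrier R" for r
  proof -
    have "\<zero> \<otimes> r \<oplus> \<zero> \<otimes> r = \<zero> \<otimes> r \<oplus> \<zero>"
      using l_distr[of \<zero> \<zero> r] r m_closed by simp
    then show "\<zero> \<otimes> r = \<zero>" using r m_closed[of \<zero> r] by simp
    have "r \<otimes> \<zero> \<oplus> r \<otimes> \<zero> = r \<otimes> \<zero> \<oplus> \<zero>"
      using r_distr[of \<zero> \<zero> r] r m_closed by simp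
    then show "r \<otimes> \<zero> = \<zero>" using r m_closed[of r \<zero>] by simp
  qed
  have neg: "(\<ominus> s) \<otimes> r = \<ominus> (s \<otimes> r)" "r \<otimes> (\<ominus> s) = \<ominus> (r \<otimes> s)"
    if "r \<in> carrier R" "s \<in> carrier R" for r s
  proof -
    have "(\<ominus> s) \<otimes> r \<oplus> s \<otimes> r = \<zero>"
      using that l_distr[of "\<ominus> s" s r] z(1) l_neg by simp
    then show "(\<ominus> s) \<otimes> r = \<ominus> (s \<otimes> r)"
      using that m_closed by (metis a_inv_closed minus_equality)
    have "r \<otimes> (\<ominus> s) \<oplus> r \<otimes> s = \<zero>"
      using that r_distr[of "\<ominus> s" s r] z(2) l_neg by simp
    then show "r \<otimes> (\<ominus> s) = \<ominus> (r \<otimes> s)"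
      using that m_closed by (metis a_inv_closed minus_equality)
  qed
  have "subgroup (ring_center R) (add_monoid R)"
  proof (rule add.subgroupI)
    show "ring_center R \<subseteq> carrier R" by (auto simp: ring_center_def)
    show "ring_center R \<noteq> {}" using z by (auto simp: ring_center_def)
    show "\<ominus> a \<in> ring_center R" if "a \<in> ring_center R" for a
      using that neg by (auto simp: ring_center_def)
    show "a \<oplus> b \<in> ring_center R" if "a \<in> ring_center R" "b \<in> ring_center R" for a b
      using that by (auto simp: ring_center_def l_distr r_distr)
  qed
  then show ?thesis by (rule additive_subgroup.intro)
qed

end

theory Submission
  imports Defs "HOL-Algebra.Multiplicative_Group"
begin

text \<open>
  The centralizers \<open>C(r)\<close> of the non-central elements are proper additive subgroups that cover
  \<open>R\<close>, since \<open>r\<close> lies in \<open>C(r)\<close> and the center lies in all of them; their intersection is \<open>Z(R)\<close>.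
  As \<open>R\<close> has \<open>p\<close>-power order, each of them has index at least \<open>p\<close>. Together with \<open>R\<close>
  itself, the centralizer of a central element, they make up \<open>Cent(R)\<close>. So the inequality
  says that a finite group is not covered by fewer than \<open>p + 1\<close> subgroups of index at least \<open>p\<close>
  (\<open>card_cover_ge\<close>).

  Equality means that the cover has exactly \<open>p + 1\<close> members. Every inequality in the counting
  argument is then an equality, so that all members have index \<open>p\<close> and any two of them meet in
  the intersection of the whole cover, which has index \<open>p\<^sup>2\<close>
  (\<open>card_Inter_minimal_cover\<close>). Hence \<open>Z(R)\<close> has index \<open>p\<^sup>2\<close>. Conversely, if \<open>Z(R)\<close> has
  index \<open>p\<^sup>2\<close>, then every proper centralizer lies strictly between \<open>Z(R)\<close> and \<open>R\<close> and has index
  \<open>p\<close>; two distinct ones meet in \<open>Z(R)\<close>, so that outside \<open>Z(R)\<close> they partition \<open>R\<close>, and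
  counting elements shows that there are \<open>p + 1\<close> of them
  (\<open>card_proper_centralizers_if_index_center\<close>).

  It remains to see that a quotient \<open>R/Z(R)\<close> of order \<open>p\<^sup>2\<close> is \<open>\<int>\<^sub>p \<times> \<int>\<^sub>p\<close>. The other group
  of that order is cyclic, and \<open>R/Z(R)\<close> cannot be: \<open>R\<close> would be generated by its center and
  one element, hence commutative (\<open>not_cyclic_mod_ring_center\<close>).
\<close>

section \<open>Covering a finite group by proper subgroups\<close>

text \<open>
  The product map \<open>A \<times> B \<rightarrow> G\<close> has fibres of size at most \<open>|A \<inter> B|\<close>: two pairs with the same
  product \<open>a b = a0 b0\<close> differ by \<open>inv a0 a = b0 inv b\<close>, which lies in both subgroups.
\<close>

lemma (in group) card_mult_subgroups_le:
  assumes fin: "finite (carrier G)" and A: "subgroup A G" and B: "subgroup B G"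
  shows "card A * card B \<le> order G * card (A \<inter> B)"
proof -
  have AG: "A \<subseteq> carrier G" and BG: "B \<subseteq> carrier G"
    using A B by (auto dest: subgroup.subset)
  have finA: "finite A" and finB: "finite B"
    using AG BG fin finite_subset by auto
  let ?f = "\<lambda>(a, b). a \<otimes> b"
  have fibre: "card {z \<in> A \<times> B. ?f z = y} \<le> card (A \<inter> B)" for y
  proof (cases "\<exists>a0\<in>A. \<exists>b0\<in>B. a0 \<otimes> b0 = y")
    case True
    then obtain a0 b0 where 0: "a0 \<in> A" "b0 \<in> B" "a0 \<otimes> b0 = y" by blast
    let ?g = "\<lambda>(a, b). inv a0 \<otimes> a"
    show ?thesis
    proof (rule card_inj_on_le[of ?g])
      show "inj_on ?g {z \<in> A \<times> B. ?f z = y}"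
      proof (rule inj_onI)
        fix u v
        assume uv: "u \<in> {z \<in> A \<times> B. ?f z = y}" "v \<in> {z \<in> A \<times> B. ?f z = y}" "?g u = ?g v"
        obtain a b c d where eq: "u = (a, b)" "v = (c, d)" by (cases u, cases v)
        have carr: "a \<in> carrier G" "b \<in> carrier G" "c \<in> carrier G" "d \<in> carrier G"
          "a0 \<in> carrier G"
          using uv eq 0 AG BG by auto
        have "a = c" using uv(3) eq carr by simp
        moreover have "a \<otimes> b = c \<otimes> d" using uv(1,2) eq by simp
        ultimately show "u = v" using eq carr by simp
      qed
      show "?g ` {z \<in> A \<times> B. ?f z = y} \<subseteq> A \<inter> B"
      proof (rule image_subsetI)
        fix z assume "z \<in> {z \<in> A \<times> B. ?f z = y}"
        then obtain a b where ab: "a \<in> A" "b \<in> B" "a \<otimes> b = y" "z = (a, b)" by auto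
        have carr: "a \<in> carrier G" "b \<in> carrier G" "a0 \<in> carrier G" "b0 \<in> carrier G"
          using ab 0 AG BG by auto
        have "inv a0 \<otimes> a \<otimes> b = inv a0 \<otimes> (a0 \<otimes> b0)"
          using ab 0 carr by (simp add: m_assoc)
        also have "\<dots> = b0" using carr by (simp add: m_assoc[symmetric])
        finally have "inv a0 \<otimes> a = b0 \<otimes> inv b" using carr
          by (metis inv_closed inv_solve_right m_closed)
        then have "inv a0 \<otimes> a \<in> B"
          using ab 0 B by (simp add: subgroup.m_closed subgroup.m_inv_closed)
        then show "?g z \<in> A \<inter> B"
          using ab 0 A by (simp add: subgroup.m_closed subgroup.m_inv_closed)
      qed
      show "finite (A \<inter> B)" using finA by simp
    qed
  next
    case False
    then have "{z \<in> A \<times> B. ?f z = y} = {}" by auto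
    then show ?thesis by (metis card.empty le0)
  qed
  have img: "?f ` (A \<times> B) \<subseteq> carrier G" using AG BG by auto
  have "card A * card B = card (A \<times> B)" by (simp add: card_cartesian_product)
  also have "\<dots> = (\<Sum>y\<in>carrier G. card {z \<in> A \<times> B. ?f z = y})"
    using sum.group[OF _ fin img, of "\<lambda>_. 1::nat"] finA finB by simp
  also have "\<dots> \<le> (\<Sum>y\<in>carrier G. card (A \<inter> B))" by (rule sum_mono) (rule fibre)
  also have "\<dots> = order G * card (A \<inter> B)" by (simp add: order_def)
  finally show ?thesis .
qed

text \<open>
  Relative to its size, a subgroup \<open>B\<close> has at most as much outside of \<open>A\<close> as the whole group
  has. This is the estimate from which all counting over a cover proceeds.
\<close>

lemma (in group) card_diff_subgroups_le:
  assumes fin: "finite (carrier G)" and A: "subgroup A G" and B: "subgroup B G"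
  shows "order G * card (B - A) \<le> card (carrier G - A) * card B"
proof -
  have AG: "A \<subseteq> carrier G" and BG: "B \<subseteq> carrier G"
    using A B by (auto dest: subgroup.subset)
  have B_split: "card (B - A) + card (A \<inter> B) = card B"
    using finite_subset[OF BG fin] by (metis Int_commute add.commute card_Int_Diff)
  have G_split: "order G = card (carrier G - A) + card A"
    unfolding order_def using card_Diff_subset[OF finite_subset[OF AG fin] AG] card_mono[OF fin AG]
    by simp
  have "order G * card (B - A) + card A * card B
      \<le> order G * card (B - A) + order G * card (A \<inter> B)"
    using card_mult_subgroups_le[OF assms] by simp
  also have "\<dots> = order G * card B" by (metis B_split distrib_left)
  also have "\<dots> = card (carrier G - A) * card B + card A * card B"
    by (simp add: G_split distrib_right)
  finally show ?thesis by simp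
qed

text \<open>
  The members other than \<open>A\<close> have to cover the complement of \<open>A\<close>. By the preceding estimate each
  \<open>B\<close> contributes to it at most \<open>|B| / |G|\<close> of its size, so these fractions add up to at
  least 1. Omitting \<open>A\<close> makes the bounds below sharp.
\<close>

lemma (in group) order_le_sum_card_cover:
  assumes fin: "finite (carrier G)" and F: "\<And>B. B \<in> F \<Longrightarrow> subgroup B G"
    and cover: "\<Union>F = carrier G" and A: "A \<in> F" "A \<noteq> carrier G"
  shows "order G \<le> (\<Sum>B\<in>F - {A}. card B)"
proof -
  let ?d = "card (carrier G - A)"
  have finF: "finite F" using finite_UnionD[of F] cover fin by simp
  have AG: "A \<subset> carrier G" using A cover by blast
  then have d: "?d > 0" using fin by (simp add: card_gt_0_iff)
  have "?d \<le> card (\<Union>B\<in>F - {A}. B - A)"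
    by (rule card_mono) (use cover finF fin in \<open>auto intro: finite_subset\<close>)
  also have "\<dots> \<le> (\<Sum>B\<in>F - {A}. card (B - A))" by (rule card_UN_le) (use finF in simp)
  finally have "order G * ?d \<le> (\<Sum>B\<in>F - {A}. order G * card (B - A))"
    by (simp flip: sum_distrib_left)
  also have "\<dots> \<le> (\<Sum>B\<in>F - {A}. ?d * card B)"
    using card_diff_subgroups_le[OF fin F F] A by (intro sum_mono) auto
  also have "\<dots> = (\<Sum>B\<in>F - {A}. card B) * ?d" by (simp add: sum_distrib_left mult.commute)
  finally show ?thesis using d by simp
qed

text \<open>
  Without one member, the orders of the others still add up to \<open>|G|\<close>, and each is at most
  \<open>|G| / k\<close>: at least \<open>k\<close> others are needed.
\<close>

lemma (in group) card_cover_ge: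
  assumes fin: "finite (carrier G)" and F: "\<And>B. B \<in> F \<Longrightarrow> subgroup B G"
    and cover: "\<Union>F = carrier G" and k: "1 < k"
    and index: "\<And>B. B \<in> F \<Longrightarrow> k * card B \<le> order G"
  shows "k + 1 \<le> card F"
proof -
  have finF: "finite F" using finite_UnionD[of F] cover fin by simp
  have pos: "order G > 0" using fin order_gt_0_iff_finite by blast
  obtain A where A: "A \<in> F" using cover one_closed by blast
  have "A \<noteq> carrier G" using index[OF A] k pos by (auto simp: order_def)
  then have "k * order G \<le> k * (\<Sum>B\<in>F - {A}. card B)"
    using order_le_sum_card_cover[OF fin F cover A] by simp
  also have "\<dots> \<le> (\<Sum>B\<in>F - {A}. order G)"
    unfolding sum_distrib_left using index by (intro sum_mono) auto
  also have "\<dots> = card (F - {A}) * order G" by simp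
  finally have "k \<le> card (F - {A})" using pos by simp
  moreover have "card F = Suc (card (F - {A}))" by (rule card.remove[OF finF A])
  ultimately show ?thesis by simp
qed

text \<open>
  In a cover by \<open>k + 1\<close> subgroups of index at least \<open>k\<close> there is no slack in
  \<open>order_le_sum_card_cover\<close>: the \<open>k\<close> members other than \<open>A\<close> have index exactly \<open>k\<close>, and they cover
  the complement of \<open>A\<close> without overlap. An element of two members \<open>A\<close> and \<open>B\<close> can therefore
  not be outside any third one \<open>C\<close>, which makes \<open>A \<inter> B\<close> the intersection of the whole cover.
\<close>

lemma (in group) card_Inter_minimal_cover:
  assumes fin: "finite (carrier G)" and F: "\<And>B. B \<in> F \<Longrightarrow> subgroup B G"
    and cover: "\<Union>F = carrier G" and k: "1 < k"
    and index: "\<And>B. B \<in> F \<Longrightarrow> k * card B \<le> order G"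
    and cardF: "card F = k + 1"
  shows "k\<^sup>2 * card (\<Inter>F) = order G"
proof -
  have finF: "finite F" using finite_UnionD[of F] cover fin by simp
  have pos: "order G > 0" using fin order_gt_0_iff_finite by blast
  have finB: "finite B" if "B \<in> F" for B
    using F[OF that] fin by (meson finite_subset subgroup.subset)
  have card_rest: "card (F - {A}) = k" if "A \<in> F" for A using that cardF finF by simp
  have another: "\<exists>B\<in>F. B \<noteq> A" for A
  proof (rule ccontr)
    assume "\<not> ?thesis"
    then have "F \<subseteq> {A}" by blast
    then have "card F \<le> 1" using card_mono[of "{A}" F] by simp
    then show False using cardF k by simp
  qed
  have proper: "A \<noteq> carrier G" if "A \<in> F" for A
    using index[OF that] k pos by (auto simp: order_def)
  \<comment> \<open>Leave out a member \<open>A\<close> other than \<open>B\<close>: the \<open>k\<close> remaining orders are at most \<open>|G| / k\<close>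
    and add up to at least \<open>|G|\<close>.\<close>
  have index_eq: "k * card B = order G" if B: "B \<in> F" for B
  proof -
    obtain A where A: "A \<in> F" "A \<noteq> B" using another by metis
    have "k * order G \<le> k * (\<Sum>C\<in>F - {A}. card C)"
      using order_le_sum_card_cover[OF fin F cover A(1) proper[OF A(1)]] by simp
    moreover have "k * (\<Sum>C\<in>F - {A}. card C) \<le> (\<Sum>C\<in>F - {A}. order G)"
      unfolding sum_distrib_left using index by (intro sum_mono) auto
    moreover have "(\<Sum>C\<in>F - {A}. order G) = k * order G" using card_rest[OF A(1)] by simp
    ultimately have eq: "(\<Sum>C\<in>F - {A}. k * card C) = (\<Sum>C\<in>F - {A}. order G)"
      unfolding sum_distrib_left[symmetric] by linarith
    show ?thesis
      by (rule sum_mono_inv[OF eq]) (use A B finF index in auto)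
  qed
  have diff_le: "k * card (B - A) \<le> card (carrier G - A)" if "A \<in> F" "B \<in> F" for A B
  proof -
    have "order G * (k * card (B - A)) \<le> card (carrier G - A) * (k * card B)"
      using card_diff_subgroups_le[OF fin F F, OF that] by (simp add: mult.left_commute)
    then show ?thesis using pos index_eq[OF that(2)] by (simp add: mult.commute)
  qed
  \<comment> \<open>Count the pairs of a member \<open>B\<close> and a point of \<open>B\<close> outside \<open>A\<close> in two ways.\<close>
  have count: "(\<Sum>x\<in>carrier G - A. card {B \<in> F - {A}. x \<in> B}) = (\<Sum>B\<in>F - {A}. card (B - A))"
    if "A \<in> F" for A
  proof (rule sum_multicount_gen)
    show "\<forall>B\<in>F - {A}. card {x \<in> carrier G - A. x \<in> B} = card (B - A)"
    proof
      fix B assume "B \<in> F - {A}"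
      then have "{x \<in> carrier G - A. x \<in> B} = B - A" using cover by blast
      then show "card {x \<in> carrier G - A. x \<in> B} = card (B - A)" by simp
    qed
  qed (use fin finF in auto)
  have covered: "1 \<le> card {B \<in> F - {A}. x \<in> B}" if "x \<in> carrier G - A" for x A
  proof -
    have "{B \<in> F - {A}. x \<in> B} \<noteq> {}" using that cover by blast
    then show ?thesis using finF by (simp add: Suc_le_eq card_gt_0_iff)
  qed
  have total: "k * (\<Sum>B\<in>F - {A}. card (B - A)) = k * card (carrier G - A)" if A: "A \<in> F" for A
  proof (rule antisym)
    have "k * (\<Sum>B\<in>F - {A}. card (B - A)) \<le> (\<Sum>B\<in>F - {A}. card (carrier G - A))"
      unfolding sum_distrib_left using diff_le A by (intro sum_mono) auto
    then show "k * (\<Sum>B\<in>F - {A}. card (B - A)) \<le> k * card (carrier G - A)"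
      using card_rest[OF A] by simp
    have "(\<Sum>x\<in>carrier G - A. 1) \<le> (\<Sum>x\<in>carrier G - A. card {B \<in> F - {A}. x \<in> B})"
      using covered by (intro sum_mono) auto
    then show "k * card (carrier G - A) \<le> k * (\<Sum>B\<in>F - {A}. card (B - A))"
      using count[OF A] by simp
  qed
  have once: "card {B \<in> F - {A}. x \<in> B} = 1" if A: "A \<in> F" and x: "x \<in> carrier G - A" for x A
  proof -
    have "(\<Sum>x\<in>carrier G - A. 1) = (\<Sum>x\<in>carrier G - A. card {B \<in> F - {A}. x \<in> B})"
      using count[OF A] total[OF A] k by simp
    from sum_mono_inv[OF this covered x] fin show ?thesis by simp
  qed
  have diff_eq: "k * card (B - A) = card (carrier G - A)" if "A \<in> F" "B \<in> F" "A \<noteq> B" for A B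
  proof -
    have eq: "(\<Sum>B\<in>F - {A}. k * card (B - A)) = (\<Sum>B\<in>F - {A}. card (carrier G - A))"
      using total[OF that(1)] card_rest[OF that(1)] by (simp add: sum_distrib_left)
    show ?thesis
      by (rule sum_mono_inv[OF eq]) (use that finF diff_le in auto)
  qed
  obtain A where A: "A \<in> F" using cover one_closed by blast
  obtain B where B: "B \<in> F" "B \<noteq> A" using another by blast
  have "A \<inter> B \<subseteq> C" if C: "C \<in> F" for C
  proof (rule subsetI, rule ccontr)
    fix x assume x: "x \<in> A \<inter> B" "x \<notin> C"
    then have "{A, B} \<subseteq> {D \<in> F - {C}. x \<in> D}" using A B by auto
    then have "card {A, B} \<le> card {D \<in> F - {C}. x \<in> D}" using finF by (intro card_mono) auto
    moreover have "x \<in> carrier G - C" using x A cover by blast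
    ultimately show False using once[OF C] B by simp
  qed
  then have Inter: "\<Inter>F = A \<inter> B" using A B by blast
  have "card (B - A) + card (A \<inter> B) = card B"
    using finB[OF B(1)] by (metis Int_commute add.commute card_Int_Diff)
  then have "k * card (B - A) + k * card (A \<inter> B) = order G"
    using index_eq[OF B(1)] by (metis distrib_left)
  moreover have "order G = card (carrier G - A) + card A"
  proof -
    have "A \<subseteq> carrier G" using A cover by blast
    then show ?thesis
      using card_Diff_subset[OF finB[OF A]] card_mono[OF fin] by (simp add: order_def)
  qed
  ultimately have "k * card (A \<inter> B) = card A" using diff_eq[OF A B(1)] B by simp
  then have "k * (k * card (A \<inter> B)) = order G" using index_eq[OF A] by simp
  then show ?thesis by (simp add: Inter power2_eq_square mult.assoc)
qed

section \<open>Groups of prime power order\<close>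

lemma (in group) card_psubset_subgroup_prime_power:
  assumes p: "prime (p::nat)" and G: "order G = p ^ n"
    and H: "subgroup H G" and K: "subgroup K G" and HK: "H \<subset> K"
  shows "p * card H \<le> card K"
proof -
  have "finite (carrier G)"
    using G p order_gt_0_iff_finite by (simp add: prime_gt_0_nat)
  then have "finite K" using K by (meson finite_subset subgroup.subset)
  then have less: "card H < card K" using HK by (rule psubset_card_mono)
  have "card H dvd p ^ n" "card K dvd p ^ n" using lagrange H K G by (metis dvd_triv_right)+
  then obtain i j where ij: "card H = p ^ i" "card K = p ^ j"
    unfolding divides_primepow_nat[OF p] by auto
  then have "i < j" using less p by (metis power_less_imp_less_exp prime_gt_1_nat)
  then have "p ^ Suc i \<le> p ^ j" using p by (intro power_increasing)
    (auto simp: Suc_leI prime_gt_0_nat)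
  then show ?thesis using ij by simp
qed

lemma (in group) integer_mod_group_ord_iso:
  assumes a: "a \<in> carrier G" and pos: "ord a > 0"
  shows "integer_mod_group (ord a) \<cong> subgroup_generated G {a}"
proof -
  let ?h = "\<lambda>k::int. a [^] k"
  have carr: "carrier (subgroup_generated G {a}) = range ?h"
    using carrier_subgroup_generated_by_singleton[OF a] .
  have pow_mod: "a [^] (k mod int (ord a)) = a [^] k" for k
  proof -
    have "a [^] k = a [^] (k mod int (ord a) + int (ord a) * (k div int (ord a)))" by simp
    also have "\<dots> = a [^] (k mod int (ord a)) \<otimes> a [^] (int (ord a) * (k div int (ord a)))"
      using a by (simp only: int_pow_mult)
    also have "a [^] (int (ord a) * (k div int (ord a))) = \<one>" using a by (simp add: int_pow_eq_id)
    finally show ?thesis using a by simp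
  qed
  have "?h \<in> hom (integer_mod_group (ord a)) (subgroup_generated G {a})"
    by (rule homI) (use a in \<open>auto simp: carr pow_mod int_pow_mult\<close>)
  moreover have img: "?h ` carrier (integer_mod_group (ord a)) = range ?h"
  proof -
    have "?h k \<in> ?h ` {0..<int (ord a)}" for k
      using pow_mod[of k] pos by (intro image_eqI[of _ _ "k mod int (ord a)"]) auto
    then show ?thesis using pos by (auto simp: carrier_integer_mod_group)
  qed
  moreover have "inj_on ?h (carrier (integer_mod_group (ord a)))"
  proof (rule inj_onI)
    fix k l assume kl: "k \<in> carrier (integer_mod_group (ord a))"
      "l \<in> carrier (integer_mod_group (ord a))" "a [^] k = a [^] l"
    then have "a [^] (k - l) = \<one>" using a by (simp add: int_pow_diff)
    then have "int (ord a) dvd k - l" using a by (simp add: int_pow_eq_id)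
    then show "k = l" using kl pos
      by (simp add: carrier_integer_mod_group) (metis mod_eq_dvd_iff mod_pos_pos_trivial)
  qed
  ultimately have "?h \<in> iso (integer_mod_group (ord a)) (subgroup_generated G {a})"
    by (simp add: iso_def bij_betw_def carr)
  then show ?thesis by (rule is_isoI)
qed

text \<open>
  Without a generator every element \<open>a \<noteq> \<one>\<close> has order \<open>p\<close>. The cyclic subgroup of such an \<open>a\<close>
  and that of any \<open>b\<close> outside it have prime order and are distinct, hence meet trivially; their
  product has \<open>p\<^sup>2\<close> elements, so that the group is their direct product.
\<close>

lemma (in comm_group) noncyclic_prime_square_order_iso:
  assumes p: "prime (p::nat)" and G: "order G = p\<^sup>2" and noncyclic: "\<not> cyclic_group G"
  shows "G \<cong> integer_mod_group p \<times>\<times> integer_mod_group p"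
proof -
  have fin: "finite (carrier G)"
    using G p order_gt_0_iff_finite by (simp add: prime_gt_0_nat)
  have ord_p: "ord a = p" if a: "a \<in> carrier G" "a \<noteq> \<one>" for a
  proof -
    have "ord a dvd p\<^sup>2" using ord_dvd_group_order[OF a(1)] G by simp
    then obtain i where i: "i \<le> 2" "ord a = p ^ i" using divides_primepow_nat[OF p] by blast
    have "i \<noteq> 0" using i a ord_eq_1[OF a(1)] by auto
    moreover have "i \<noteq> 2"
    proof
      assume "i = 2"
      then have "card (generate G {a}) = card (carrier G)"
        using i G generate_pow_card[OF a(1)] by (simp add: order_def)
      then have "generate G {a} = carrier G"
        using fin a by (intro card_subset_eq) (auto simp: generate_incl)
      then have "carrier (subgroup_generated G {a}) = carrier G"
        using a by (simp add: carrier_subgroup_generated)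
      then have "carrier G = range (\<lambda>n::int. a [^] n)"
        using carrier_subgroup_generated_by_singleton[OF a(1)] by simp
      then show False using noncyclic a cyclic_group by blast
    qed
    ultimately have "i = 1" using i(1) by simp
    then show ?thesis using i(2) by simp
  qed
  let ?gen = "\<lambda>a. carrier (subgroup_generated G {a})"
  have sub: "subgroup (?gen a) G" for a by (rule subgroup_subgroup_generated)
  have gen_self: "a \<in> ?gen a" if "a \<in> carrier G" for a
    using that by (simp add: carrier_subgroup_generated generate.incl)
  have gen_gen: "subgroup_generated G (?gen a) = subgroup_generated G {a}" for a
  proof -
    have "carrier (subgroup_generated G (?gen a)) = carrier (subgroup_generated G {a})"
      by (rule subgroup.carrier_subgroup_generated_subgroup[OF sub])
    then show ?thesis by (intro monoid.equality) (simp_all add: subgroup_generated_def)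
  qed
  have gen_iso: "integer_mod_group p \<cong> subgroup_generated G {a}" if "a \<in> carrier G" "a \<noteq> \<one>" for a
    using integer_mod_group_ord_iso[OF that(1)] ord_p[OF that] prime_gt_0_nat[OF p] by simp
  have card_gen: "card (?gen a) = p" if "a \<in> carrier G" "a \<noteq> \<one>" for a
    using ord_p[OF that] generate_pow_card[OF that(1)] that
    by (simp add: carrier_subgroup_generated)
  have "1 < card (carrier G)" using G prime_gt_1_nat[OF p]
    by (simp add: order_def power2_eq_square one_less_mult)
  then have "carrier G \<noteq> {\<one>}" by auto
  then obtain a where a: "a \<in> carrier G" "a \<noteq> \<one>" using one_closed by blast
  have "card (?gen a) \<noteq> card (carrier G)" using card_gen[OF a] G p prime_gt_1_nat[OF p]
    by (simp add: order_def power2_eq_square)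
  then have "?gen a \<noteq> carrier G" by metis
  moreover have genG: "?gen a \<subseteq> carrier G" by (rule subgroup.subset[OF sub])
  ultimately obtain b where b: "b \<in> carrier G" "b \<notin> ?gen a" by blast
  have b1: "b \<noteq> \<one>" using b subgroup.one_closed[OF sub] by metis
  interpret group_disjoint_sum G "?gen a" "?gen b"
    by (rule group_disjoint_sum.intro[OF is_group sub sub])
  have disj: "?gen a \<inter> ?gen b \<subseteq> {\<one>}"
  proof
    fix c assume c: "c \<in> ?gen a \<inter> ?gen b"
    show "c \<in> {\<one>}"
    proof (rule ccontr)
      assume "c \<notin> {\<one>}"
      moreover have cG: "c \<in> carrier G" using c genG by (meson IntD1 subsetD)
      ultimately have pc: "card (?gen c) = p" using card_gen[OF cG] by simp
      have eq: "?gen c = ?gen d" if d: "c \<in> ?gen d" "card (?gen d) = p" for d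
      proof (rule card_subset_eq)
        show "?gen c \<subseteq> ?gen d" by (rule subgroup_generated_minimal[OF sub]) (use d in simp)
        show "finite (?gen d)" using d p by (metis card.infinite not_prime_0)
        show "card (?gen c) = card (?gen d)" using pc d by simp
      qed
      have "?gen a = ?gen b"
        using eq[OF IntD1[OF c] card_gen[OF a]] eq[OF IntD2[OF c] card_gen[OF b(1) b1]]
        by (rule trans[OF sym])
      then show False using b(2) gen_self[OF b(1)] by metis
    qed
  qed
  have "?gen a <#> ?gen b = carrier G"
  proof (rule card_subset_eq[OF fin])
    show "?gen a <#> ?gen b \<subseteq> carrier G"
      by (intro set_mult_closed subgroup.subset[OF sub])
    have "?gen a <#> ?gen b = (\<lambda>(x, y). x \<otimes> y) ` (?gen a \<times> ?gen b)"
      by (auto simp: set_mult_def)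
    moreover have "inj_on (\<lambda>(x, y). x \<otimes> y) (?gen a \<times> ?gen b)"
      using disj unfolding cancel by (auto simp: inj_on_def)
    ultimately show "card (?gen a <#> ?gen b) = card (carrier G)"
      using card_gen[OF a] card_gen[OF b(1) b1] G
      by (simp add: card_image card_cartesian_product order_def power2_eq_square)
  qed
  with disj have "subgroup_generated G (?gen a) \<times>\<times> subgroup_generated G (?gen b) \<cong> G"
    using iso_group_mul[OF comm_group_axioms] by (metis is_isoI)
  then have "subgroup_generated G {a} \<times>\<times> subgroup_generated G {b} \<cong> G"
    by (simp only: gen_gen)
  with group.DirProd_iso_trans[OF group_integer_mod_group gen_iso[OF a] gen_iso[OF b(1) b1]]
  have "integer_mod_group p \<times>\<times> integer_mod_group p \<cong> G" by (rule iso_trans)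
  then show ?thesis
    by (rule group.iso_sym[OF DirProd_group[OF group_integer_mod_group group_integer_mod_group]])
qed

section \<open>The cover of a ring by its proper centralizers\<close>

definition proper_centralizers :: "('a, 'm) ring_scheme \<Rightarrow> 'a set set"
  where "proper_centralizers R = ring_centralizer R ` (carrier R - ring_center R)"

context nonunital_ring
begin

lemma subgroup_ring_center: "subgroup (ring_center R) (add_monoid R)"
  using additive_subgroup_ring_center by (rule additive_subgroup.a_subgroup)

lemma ring_center_subset_carrier: "ring_center R \<subseteq> carrier R"
  by (auto simp: ring_center_def)

lemma subgroup_ring_centralizer:
  assumes r: "r \<in> carrier R"
  shows "subgroup (ring_centralizer R r) (add_monoid R)"
proof (rule add.subgroupI)
  have "\<zero> \<in> ring_center R"
    using additive_subgroup_ring_center by (rule additive_subgroup.zero_closed)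
  then have zero: "r \<otimes> \<zero> = \<zero> \<otimes> r" using r by (simp add: ring_center_def)
  then show "ring_centralizer R r \<noteq> {}" by (auto simp: ring_centralizer_def)
  show "ring_centralizer R r \<subseteq> carrier R" by (auto simp: ring_centralizer_def)
  fix s assume s: "s \<in> ring_centralizer R r"
  then have sR: "s \<in> carrier R" and rs: "r \<otimes> s = s \<otimes> r" by (auto simp: ring_centralizer_def)
  have "r \<otimes> (\<ominus> s) \<oplus> r \<otimes> s = (\<ominus> s) \<otimes> r \<oplus> s \<otimes> r"
    using r_distr[of "\<ominus> s" s r] l_distr[of "\<ominus> s" s r] sR r zero by (simp add: l_neg)
  then have "r \<otimes> (\<ominus> s) = (\<ominus> s) \<otimes> r" using rs sR r by (simp add: m_closed)
  then show "\<ominus> s \<in> ring_centralizer R r" using sR by (simp add: ring_centralizer_def)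
  fix t assume "t \<in> ring_centralizer R r"
  then show "s \<oplus> t \<in> ring_centralizer R r"
    using s r by (auto simp: ring_centralizer_def l_distr r_distr)
qed

lemma self_in_ring_centralizer: "r \<in> carrier R \<Longrightarrow> r \<in> ring_centralizer R r"
  by (simp add: ring_centralizer_def)

lemma ring_center_subset_centralizer: "r \<in> carrier R \<Longrightarrow> ring_center R \<subseteq> ring_centralizer R r"
  by (auto simp: ring_center_def ring_centralizer_def)

lemma ring_centralizer_eq_carrier_iff:
  assumes "r \<in> carrier R"
  shows "ring_centralizer R r = carrier R \<longleftrightarrow> r \<in> ring_center R"
proof -
  have "ring_centralizer R r = carrier R \<longleftrightarrow> (\<forall>s\<in>carrier R. r \<otimes> s = s \<otimes> r)"
    unfolding ring_centralizer_def by blast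
  then show ?thesis using assms by (auto simp: ring_center_def)
qed

lemma ring_center_eq_Inter: "ring_center R = carrier R \<inter> \<Inter>(proper_centralizers R)"
proof
  show "ring_center R \<subseteq> carrier R \<inter> \<Inter>(proper_centralizers R)"
    using ring_center_subset_centralizer by (auto simp: proper_centralizers_def ring_center_def)
  show "carrier R \<inter> \<Inter>(proper_centralizers R) \<subseteq> ring_center R"
  proof
    fix s assume s: "s \<in> carrier R \<inter> \<Inter>(proper_centralizers R)"
    have "r \<otimes> s = s \<otimes> r" if r: "r \<in> carrier R" for r
    proof (cases "r \<in> ring_center R")
      case True
      then show ?thesis using s by (simp add: ring_center_def)
    next
      case False
      then have "ring_centralizer R r \<in> proper_centralizers R"
        using r by (simp add: proper_centralizers_def)
      then have "s \<in> ring_centralizer R r" using s by blast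
      then show ?thesis by (simp add: ring_centralizer_def)
    qed
    then show "s \<in> ring_center R" using s by (simp add: ring_center_def)
  qed
qed

lemma card_ring_Cent:
  assumes "finite (carrier R)"
  shows "card (ring_Cent R) = Suc (card (proper_centralizers R))"
proof -
  have "\<zero> \<in> ring_center R"
    using additive_subgroup_ring_center by (rule additive_subgroup.zero_closed)
  then have "ring_Cent R = insert (carrier R) (proper_centralizers R)"
    using ring_centralizer_eq_carrier_iff
    by (fastforce simp: ring_Cent_def proper_centralizers_def)
  moreover have "carrier R \<notin> proper_centralizers R"
    using ring_centralizer_eq_carrier_iff by (auto simp: proper_centralizers_def)
  ultimately show ?thesis using assms by (simp add: proper_centralizers_def)
qed

lemma Union_proper_centralizers:
  assumes "ring_center R \<noteq> carrier R"
  shows "\<Union>(proper_centralizers R) = carrier R"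
proof
  show "\<Union>(proper_centralizers R) \<subseteq> carrier R"
    by (auto simp: proper_centralizers_def ring_centralizer_def)
  have "ring_center R \<subset> carrier R" using assms ring_center_subset_carrier by blast
  then obtain r where r: "r \<in> carrier R" "r \<notin> ring_center R" by blast
  show "carrier R \<subseteq> \<Union>(proper_centralizers R)"
  proof
    fix s assume "s \<in> carrier R"
    then show "s \<in> \<Union>(proper_centralizers R)"
      using r self_in_ring_centralizer ring_center_subset_centralizer[of r]
      by (cases "s \<in> ring_center R") (auto simp: proper_centralizers_def)
  qed
qed

text \<open>
  If \<open>Z(R) + r\<close> generates \<open>R/Z(R)\<close>, then the image of the subgroup \<open>C(r)\<close> is the whole quotient.
  As \<open>C(r)\<close> contains \<open>Z(R)\<close>, this gives \<open>C(r) = R\<close>. So \<open>r\<close> is central, the generator is trivial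
  and \<open>R = Z(R)\<close>.
\<close>

lemma not_cyclic_mod_ring_center:
  assumes noncomm: "ring_center R \<noteq> carrier R"
  shows "\<not> cyclic_group (R A_Mod ring_center R)"
proof
  let ?Q = "R A_Mod ring_center R"
  assume "cyclic_group ?Q"
  interpret Z: abelian_subgroup "ring_center R" R
    by (intro abelian_subgroupI3 additive_subgroup_ring_center abelian_group_axioms)
  interpret h: group_hom "add_monoid R" ?Q "\<lambda>a. ring_center R +> a"
    by (intro group_hom.intro group_hom_axioms.intro a_group Z.a_factorgroup_is_group
        Z.a_r_coset_hom_A_Mod)
  have carrQ: "carrier ?Q = (\<lambda>a. ring_center R +> a) ` carrier R"
    by (auto simp: A_FactGroup_def FactGroup_def A_RCOSETS_def' RCOSETS_def a_r_coset_def)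
  obtain X where X: "X \<in> carrier ?Q" "subgroup_generated ?Q {X} = ?Q"
    using \<open>cyclic_group ?Q\<close> by (auto simp: cyclic_group_def)
  then obtain r where r: "r \<in> carrier R" "X = ring_center R +> r" using carrQ by auto
  let ?C = "(\<lambda>a. ring_center R +> a) ` ring_centralizer R r"
  have "carrier (subgroup_generated ?Q {X}) \<subseteq> ?C"
    by (rule h.H.subgroup_generated_minimal)
      (use h.subgroup_img_is_subgroup subgroup_ring_centralizer r self_in_ring_centralizer in auto)
  then have QC: "carrier ?Q \<subseteq> ?C" using X by simp
  have all: "carrier R \<subseteq> ring_centralizer R r"
  proof
    fix s assume s: "s \<in> carrier R"
    then obtain t where t: "t \<in> ring_centralizer R r" "ring_center R +> s = ring_center R +> t"
      using QC carrQ by blast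
    have "s \<in> ring_center R +> t" using Z.a_rcos_self[OF s] t by simp
    then obtain z where z: "z \<in> ring_center R" "s = z \<oplus> t"
      by (auto simp: a_r_coset_def')
    then show "s \<in> ring_centralizer R r"
      using t subgroup.m_closed[OF subgroup_ring_centralizer[OF r(1)]]
        ring_center_subset_centralizer[OF r(1)] by auto
  qed
  then have "r \<in> ring_center R"
    using ring_centralizer_eq_carrier_iff[OF r(1)] by (auto simp: ring_centralizer_def)
  then have "X = ring_center R" using r Z.a_rcos_const by simp
  then have "X = \<one>\<^bsub>?Q\<^esub>" by (simp add: A_FactGroup_def FactGroup_def)
  then have "carrier (subgroup_generated ?Q {X}) \<subseteq> {\<one>\<^bsub>?Q\<^esub>}"
    by (intro h.H.subgroup_generated_minimal h.H.triv_subgroup) simp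
  then have triv: "carrier ?Q \<subseteq> {ring_center R}"
    using X by (simp add: A_FactGroup_def FactGroup_def)
  have "carrier R \<subseteq> ring_center R"
  proof
    fix s assume s: "s \<in> carrier R"
    then have "ring_center R +> s = ring_center R" using triv carrQ by blast
    then show "s \<in> ring_center R" using Z.a_rcos_self[OF s] by simp
  qed
  then have "ring_center R = carrier R" by (rule antisym[OF ring_center_subset_carrier])
  with noncomm show False by (rule notE)
qed

end

section \<open>Non-commutative rings of prime power order\<close>

locale noncommutative_p_ring = nonunital_ring +
  fixes p n :: nat
  assumes prime: "prime p"
    and order: "order R = p ^ n"
    and noncomm: "ring_center R \<noteq> carrier R"
begin

lemma finite_carrier: "finite (carrier R)"
proof (rule ccontr)
  \<comment> \<open>An infinite set has cardinality 0, which is no power of \<open>p\<close>.\<close>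
  assume "infinite (carrier R)"
  then show False using order prime by (simp add: order_def)
qed

lemma order_add_monoid: "Coset.order (add_monoid R) = p ^ n"
  using order by (simp add: order_def)

lemma proper_centralizer_index:
  assumes "C \<in> proper_centralizers R"
  shows "p * card C \<le> card (carrier R)"
proof -
  obtain r where r: "r \<in> carrier R" "r \<notin> ring_center R" "C = ring_centralizer R r"
    using assms by (auto simp: proper_centralizers_def)
  have "C \<subset> carrier R"
    using r ring_centralizer_eq_carrier_iff by (auto simp: ring_centralizer_def)
  then show ?thesis
    using add.card_psubset_subgroup_prime_power[OF prime order_add_monoid _ add.subgroup_self]
      subgroup_ring_centralizer r by simp
qed

lemma proper_centralizer_over_center:
  assumes "C \<in> proper_centralizers R"
  shows "p * card (ring_center R) \<le> card C"
proof -
  obtain r where r: "r \<in> carrier R" "r \<notin> ring_center R" "C = ring_centralizer R r"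
    using assms by (auto simp: proper_centralizers_def)
  have "ring_center R \<subset> C"
    using r ring_center_subset_centralizer self_in_ring_centralizer by blast
  then show ?thesis
    using add.card_psubset_subgroup_prime_power[OF prime order_add_monoid subgroup_ring_center]
      subgroup_ring_centralizer r by simp
qed

lemma subgroup_proper_centralizer:
  "C \<in> proper_centralizers R \<Longrightarrow> subgroup C (add_monoid R)"
  using subgroup_ring_centralizer by (auto simp: proper_centralizers_def)

lemma card_proper_centralizers_ge: "p + 1 \<le> card (proper_centralizers R)"
  using add.card_cover_ge[of "proper_centralizers R" p] finite_carrier subgroup_proper_centralizer
    Union_proper_centralizers[OF noncomm] prime_gt_1_nat[OF prime] proper_centralizer_index
  by (simp add: order_def)

lemma index_center_if_minimal_cover:
  assumes "card (proper_centralizers R) = p + 1"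
  shows "p\<^sup>2 * card (ring_center R) = card (carrier R)"
proof -
  have "proper_centralizers R \<noteq> {}" using assms by auto
  then have "\<Inter>(proper_centralizers R) = ring_center R"
    using ring_center_eq_Inter Union_proper_centralizers[OF noncomm] by blast
  then show ?thesis
    using add.card_Inter_minimal_cover[of "proper_centralizers R" p] finite_carrier
      subgroup_proper_centralizer Union_proper_centralizers[OF noncomm] prime_gt_1_nat[OF prime]
      proper_centralizer_index assms
    by (simp add: order_def)
qed

text \<open>
  A proper centralizer \<open>C\<close> is determined by any of its non-central elements \<open>t\<close>: both \<open>C\<close> and
  \<open>C(t)\<close> have order \<open>p |Z(R)|\<close>, and so does their intersection, because it contains \<open>t\<close> and
  \<open>Z(R)\<close>.
  The sets \<open>C - Z(R)\<close> thus partition \<open>R - Z(R)\<close>, and their number is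
  \<open>(p\<^sup>2 - 1) / (p - 1) = p + 1\<close>.
\<close>

lemma card_proper_centralizers_if_index_center:
  assumes index: "p\<^sup>2 * card (ring_center R) = card (carrier R)"
  shows "card (proper_centralizers R) = p + 1"
proof -
  let ?Z = "ring_center R"
  let ?F = "proper_centralizers R"
  have p1: "1 < p" using prime by (rule prime_gt_1_nat)
  have finF: "finite ?F" using finite_carrier by (simp add: proper_centralizers_def)
  have ZR: "?Z \<subseteq> carrier R" by (rule ring_center_subset_carrier)
  then have finZ: "finite ?Z" using finite_carrier finite_subset by blast
  have Z0: "card ?Z > 0" using finZ subgroup.one_closed[OF subgroup_ring_center]
    by (auto simp: card_gt_0_iff)
  have CR: "C \<subseteq> carrier R" if "C \<in> ?F" for C
    using that by (auto simp: proper_centralizers_def ring_centralizer_def)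
  then have finC: "finite C" if "C \<in> ?F" for C using that finite_carrier finite_subset by blast
  have ZC: "?Z \<subseteq> C" if "C \<in> ?F" for C
    using that ring_center_subset_centralizer by (auto simp: proper_centralizers_def)
  have cardC: "card C = p * card ?Z" if "C \<in> ?F" for C
  proof (rule antisym)
    have "p * card C \<le> p * (p * card ?Z)"
      using proper_centralizer_index[OF that] index by (simp add: power2_eq_square mult.assoc)
    then show "card C \<le> p * card ?Z" using p1 by simp
  qed (rule proper_centralizer_over_center[OF that])
  have unique: "C = ring_centralizer R t"
    if C: "C \<in> ?F" and t: "t \<in> C" "t \<notin> ?Z" for C t
  proof -
    have tR: "t \<in> carrier R" using CR C t by blast
    then have tF: "ring_centralizer R t \<in> ?F" using t by (simp add: proper_centralizers_def)
    have "?Z \<subset> C \<inter> ring_centralizer R t"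
      using ZC[OF C] ZC[OF tF] t self_in_ring_centralizer[OF tR] by blast
    moreover have "subgroup (C \<inter> ring_centralizer R t) (add_monoid R)"
      using C tF subgroup_proper_centralizer by (blast intro: add.subgroups_Inter_pair)
    ultimately have le: "p * card ?Z \<le> card (C \<inter> ring_centralizer R t)"
      using add.card_psubset_subgroup_prime_power[OF prime order_add_monoid subgroup_ring_center]
      by blast
    have "C \<inter> ring_centralizer R t = C"
      by (rule card_seteq) (use finC[OF C] cardC[OF C] le in auto)
    moreover have "C \<inter> ring_centralizer R t = ring_centralizer R t"
      by (rule card_seteq) (use finC[OF tF] cardC[OF tF] le in auto)
    ultimately show ?thesis by simp
  qed
  have "carrier R - ?Z = (\<Union>C\<in>?F. C - ?Z)"
    using Union_proper_centralizers[OF noncomm] by blast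
  also have "card \<dots> = (\<Sum>C\<in>?F. card (C - ?Z))"
  proof (rule card_UN_disjoint)
    show "\<forall>C\<in>?F. \<forall>D\<in>?F. C \<noteq> D \<longrightarrow> (C - ?Z) \<inter> (D - ?Z) = {}"
    proof (intro ballI impI equals0I)
      fix C D t assume "C \<in> ?F" "D \<in> ?F" "C \<noteq> D" "t \<in> (C - ?Z) \<inter> (D - ?Z)"
      then show False using unique[of C t] unique[of D t] by simp
    qed
  qed (use finF finC in auto)
  also have "\<dots> = (\<Sum>C\<in>?F. (p - 1) * card ?Z)"
    by (rule sum.cong) (use ZC finZ cardC in \<open>auto simp: card_Diff_subset diff_mult_distrib\<close>)
  also have "card (carrier R - ?Z) = (p + 1) * ((p - 1) * card ?Z)"
    using card_Diff_subset[OF finZ ZR] index[symmetric]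
    by (simp add: power2_eq_square algebra_simps)
  finally have "card ?F * ((p - 1) * card ?Z) = (p + 1) * ((p - 1) * card ?Z)" by simp
  moreover have "(p - 1) * card ?Z > 0" using p1 Z0 by simp
  ultimately show ?thesis by (metis less_numeral_extra(3) mult_cancel2)
qed

lemma order_mod_center: "order (R A_Mod ring_center R) * card (ring_center R) = card (carrier R)"
  using add.lagrange[OF subgroup_ring_center]
  by (simp add: order_def A_FactGroup_def FactGroup_def)

lemma mod_center_iso_iff_index:
  "R A_Mod ring_center R \<cong> integer_mod_group p \<times>\<times> integer_mod_group p
    \<longleftrightarrow> p\<^sup>2 * card (ring_center R) = card (carrier R)"
proof
  assume "R A_Mod ring_center R \<cong> integer_mod_group p \<times>\<times> integer_mod_group p"
  then have "order (R A_Mod ring_center R) = p\<^sup>2"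
    using iso_same_card prime_gt_0_nat[OF prime]
    by (fastforce simp: order_def carrier_integer_mod_group power2_eq_square card_cartesian_product)
  then show "p\<^sup>2 * card (ring_center R) = card (carrier R)" using order_mod_center by simp
next
  assume index: "p\<^sup>2 * card (ring_center R) = card (carrier R)"
  interpret Z: abelian_subgroup "ring_center R" R
    by (intro abelian_subgroupI3 additive_subgroup_ring_center abelian_group_axioms)
  interpret Q: comm_group "R A_Mod ring_center R" by (rule Z.a_factorgroup_is_comm_group)
  have "card (carrier R) \<noteq> 0" using finite_carrier by auto
  then have "card (ring_center R) \<noteq> 0" using index by (metis mult_0_right)
  then have "order (R A_Mod ring_center R) = p\<^sup>2"
    using order_mod_center index by (metis mult_cancel2)
  then show "R A_Mod ring_center R \<cong> integer_mod_group p \<times>\<times> integer_mod_group p"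
    using Q.noncyclic_prime_square_order_iso prime not_cyclic_mod_ring_center noncomm by blast
qed

end

theorem theorem2p12:
  fixes p :: nat and R :: "('a, 'm) ring_scheme" (structure)
  assumes "prime p"
    and "nonunital_ring R"
    and "\<exists>x\<in>carrier R. \<exists>y\<in>carrier R. x \<otimes> y \<noteq> y \<otimes> x"
    and "\<exists>n::nat. order R = p ^ n"
  shows "card (ring_Cent R) \<ge> p + 2 \<and>
    (card (ring_Cent R) = p + 2 \<longleftrightarrow>
      R A_Mod ring_center R \<cong> integer_mod_group p \<times>\<times> integer_mod_group p)"
proof -
  obtain n where "order R = p ^ n" using assms(4) by blast
  moreover have "ring_center R \<noteq> carrier R" using assms(3) by (auto simp: ring_center_def)
  ultimately interpret noncommutative_p_ring R p n
    using assms by (intro noncommutative_p_ring.intro noncommutative_p_ring_axioms.intro)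
  have "card (ring_Cent R) = card (proper_centralizers R) + 1"
    using card_ring_Cent finite_carrier by simp
  then show ?thesis
    using card_proper_centralizers_ge index_center_if_minimal_cover
      card_proper_centralizers_if_index_center mod_center_iso_iff_index by auto
qed

end
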